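(* Let $\kappa>0$ and let $$\mathcal C=\{(x,y,z)\in\mathbb R^3 \mid x^2+y^2<1/\kappa^2,\ z\ge 0\}.$$ For a $\kappa$-constrained arc $\gamma:[0,s]\to\mathbb R^3$ consider the conditions: (1) $\gamma(0)$ and $\gamma(s)$ are points of the $xy$-plane; (2) there is a sphere $S$ of radius $1/\kappa$ with centre on the negative $z$-axis such that $\gamma(0),\gamma(s)\in S$ and some point in the image of $\gamma$ lies above $S$. Then a $\kappa$-constrained arc $\gamma:[0,s]\to\mathcal C$ cannot satisfy both (1) and (2). In addition, if a $\kappa$-constrained arc $\gamma$ in $\mathbb R^3$ satisfies (2), then the diameter of its image is at least $2/\kappa$.
   Context: A $\kappa$-constrained arc is an embedded arc-length parametrised curve $\gamma:[0,s]\to\mathbb R^3$ with $\gamma(0)\ne\gamma(s)$ that is $C^1$ and piecewise $C^2$ (the second derivative fails to exist at finitely many points at most) with $\|\gamma''(t)\|\le\kappa$ for all $t$ at which $\gamma''(t)$ is defined. A point $(x,y,z)$ lies above the sphere $S$ of radius $1/\kappa$ centred at $(0,0,c)$ if $x^2+y^2\le 1/\kappa^2$ and $z>c+\sqrt{1/\kappa^2-x^2-y^2}$. *)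

theory Defs
  imports "HOL-Analysis.Analysis"
begin

(* Derivatives are taken within {0..s}, hence one-sided at the endpoints.
   Injectivity expresses embeddedness: {0..s} is compact, and the C^1 curve \<gamma>
   is an immersion because it has unit speed.
   As for every piecewise_C1_differentiable_on, piecewise C^2 means: off a finite set
   the second derivative exists and is continuous; no one-sided limits of the second
   derivative are required at the exceptional points.
   The curvature bound applies wherever the second derivative happens to exist, not only
   off a chosen exceptional set. *)
definition constrained_arc :: "real \<Rightarrow> real \<Rightarrow> (real \<Rightarrow> real^3) \<Rightarrow> bool" where
  "constrained_arc \<kappa> s \<gamma> \<longleftrightarrow>
     0 < s \<and> inj_on \<gamma> {0..s} \<and> \<gamma> 0 \<noteq> \<gamma> s \<and>
     (\<exists>\<gamma>'. (\<forall>t\<in>{0..s}. (\<gamma> has_vector_derivative \<gamma>' t) (at t within {0..s}) \<and> norm (\<gamma>' t) = 1) \<and>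
           continuous_on {0..s} \<gamma>' \<and>
           \<gamma>' piecewise_C1_differentiable_on {0..s} \<and>
           (\<forall>t\<in>{0..s}. \<forall>a. (\<gamma>' has_vector_derivative a) (at t within {0..s}) \<longrightarrow> norm a \<le> \<kappa>))"

definition half_cylinder :: "real \<Rightarrow> (real^3) set" where
  "half_cylinder \<kappa> = {p. (p$1)\<^sup>2 + (p$2)\<^sup>2 < 1 / \<kappa>\<^sup>2 \<and> p$3 \<ge> 0}"

definition z_sphere :: "real \<Rightarrow> real \<Rightarrow> (real^3) set" where
  "z_sphere \<kappa> c = sphere (vector [0, 0, c]) (1 / \<kappa>)"

definition above_sphere :: "real \<Rightarrow> real \<Rightarrow> real^3 \<Rightarrow> bool" where
  "above_sphere \<kappa> c p \<longleftrightarrow>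
     (p$1)\<^sup>2 + (p$2)\<^sup>2 \<le> 1 / \<kappa>\<^sup>2 \<and>
     p$3 > c + sqrt (1 / \<kappa>\<^sup>2 - (p$1)\<^sup>2 - (p$2)\<^sup>2)"

definition ends_in_xy_plane :: "real \<Rightarrow> (real \<Rightarrow> real^3) \<Rightarrow> bool" where
  "ends_in_xy_plane s \<gamma> \<longleftrightarrow> \<gamma> 0 $ 3 = 0 \<and> \<gamma> s $ 3 = 0"

definition passes_above_sphere :: "real \<Rightarrow> real \<Rightarrow> (real \<Rightarrow> real^3) \<Rightarrow> bool" where
  "passes_above_sphere \<kappa> s \<gamma> \<longleftrightarrow>
     (\<exists>c<0. \<gamma> 0 \<in> z_sphere \<kappa> c \<and> \<gamma> s \<in> z_sphere \<kappa> c \<and>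
            (\<exists>p\<in>\<gamma> ` {0..s}. above_sphere \<kappa> c p))"

end

theory Submission
  imports Defs
begin

text \<open>
  Write \<open>r = 1 / \<kappa>\<close>. The engine of the proof is a comparison with circles of radius \<open>r\<close>. The unit
  tangent moves on the unit sphere with speed at most \<open>\<kappa>\<close>, so its angle to any fixed direction is
  \<open>\<kappa>\<close>-Lipschitz (\<open>arccos_inner_lipschitz\<close>). Integrating the resulting bounds on the components of
  the tangent shows that, within arc length \<open>\<pi> r / 2\<close> of a point \<open>\<gamma> t0\<close>, the arc advances along the
  tangent at \<open>t0\<close> at least as far as a circle of radius \<open>r\<close>, and recedes in any normal direction at
  most as far (\<open>displacement_along_tangent\<close>, \<open>displacement_along_normal\<close>). Two consequences
  carry everything. An arc that is perpendicular to the radius at a point at distance \<open>R \<ge> r\<close> from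
  \<open>C\<close> stays outside the ball of radius \<open>r\<close> about \<open>C\<close> for a quarter turn on either side, strictly so
  if \<open>R > r\<close> (\<open>curve_stays_outside_ball\<close>). And a piece of length \<open>\<pi> r\<close> has a chord of length at
  least \<open>2 r\<close> (\<open>half_turn_chord\<close>).

  For the diameter bound, take a point \<open>\<gamma> t0\<close> of the arc farthest from the centre of \<open>S\<close>. It lies
  outside \<open>S\<close>, and the radius is perpendicular to the arc there. Since the arc is strictly outside
  \<open>S\<close> for a quarter turn on either side while its ends lie on \<open>S\<close>, it contains the whole half turn
  about \<open>t0\<close>, whose chord is at least \<open>2 r\<close>.

  For the arc in the cylinder, slide \<open>S\<close> upwards along the axis until its upper hemisphere touches
  the arc for the last time, at \<open>\<gamma> t0\<close>. No point of the arc in the cylinder is above the new sphere,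
  and near \<open>t0\<close> no point is inside it, so the arc runs on the upper hemisphere for a quarter turn on
  either side. It cannot end there, as the ends lie on the upper hemisphere of the lower sphere \<open>S\<close>.
  But the half turn about \<open>t0\<close> has a chord of length at least \<open>2 r\<close>, and the open hemisphere
  contains no two points that far apart.
\<close>

section \<open>The direction of the tangent turns at speed at most the curvature bound\<close>

lemma has_real_derivative_inner_left:
  assumes "(f has_vector_derivative f') (at t within A)"
  shows "((\<lambda>t. f t \<bullet> e) has_real_derivative f' \<bullet> e) (at t within A)"
  unfolding has_real_derivative_iff_has_vector_derivative
  by (rule bounded_linear.has_vector_derivative[OF bounded_linear_inner_left assms])

lemma has_real_derivative_inner_self:
  assumes "(f has_vector_derivative f') (at t within A)"
  shows "((\<lambda>t. f t \<bullet> f t) has_real_derivative 2 * (f t \<bullet> f')) (at t within A)"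
  unfolding has_real_derivative_iff_has_vector_derivative
  using bounded_bilinear.has_vector_derivative[OF bounded_bilinear_inner assms assms]
  by (simp add: inner_commute)

text \<open>
  The velocity \<open>d\<close> of a unit vector \<open>u\<close> is tangent to the unit sphere, so only the tangential part
  of \<open>e\<close> contributes to \<open>d \<bullet> e\<close>. The factor \<open>sqrt (1 - (u \<bullet> e)\<^sup>2)\<close>, the sine of the angle between
  \<open>u\<close> and \<open>e\<close>, cancels the singularity of the derivative of \<open>arccos\<close>.
\<close>

lemma inner_deviation_bound:
  fixes d e u :: "'a::real_inner"
  assumes "norm u = 1" and "norm e = 1" and "d \<bullet> u = 0"
  shows "\<bar>d \<bullet> e\<bar> \<le> norm d * sqrt (1 - (u \<bullet> e)\<^sup>2)"
proof -
  define w where "w = e - (u \<bullet> e) *\<^sub>R u"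
  have uu: "u \<bullet> u = 1" and ee: "e \<bullet> e = 1"
    using assms by (simp_all add: norm_eq_1)
  have "w \<bullet> w = 1 - (u \<bullet> e)\<^sup>2"
    by (simp add: w_def inner_diff_left inner_diff_right uu ee power2_eq_square inner_commute)
  then have "norm w = sqrt (1 - (u \<bullet> e)\<^sup>2)"
    by (simp add: norm_eq_sqrt_inner)
  moreover have "d \<bullet> e = d \<bullet> w"
    using assms(3) by (simp add: w_def inner_diff_right)
  ultimately show ?thesis
    using Cauchy_Schwarz_ineq2[of d w] by simp
qed

lemma abs_inner_unit_le_1:
  fixes u e :: "'a::real_inner"
  assumes "norm u = 1" and "norm e = 1"
  shows "\<bar>u \<bullet> e\<bar> \<le> 1"
  using Cauchy_Schwarz_ineq2[of u e] assms by simp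

text \<open>
  The angle itself fails to be differentiable where \<open>u\<close> passes through \<open>e\<close> or \<open>- e\<close>. Shrinking the
  inner product by a factor \<open>q < 1\<close> keeps the argument of \<open>arccos\<close> inside the open interval, and
  the bound on the derivative survives because \<open>q\<^sup>2 (1 - x\<^sup>2) \<le> 1 - (q x)\<^sup>2\<close>.
\<close>

lemma arccos_damped_inner_lipschitz:
  fixes u :: "real \<Rightarrow> 'a::real_inner"
  assumes "a \<le> b" and "0 \<le> \<kappa>" and "0 < q" and "q < 1"
    and cont: "continuous_on {a..b} u"
    and unit: "\<And>t. t \<in> {a..b} \<Longrightarrow> norm (u t) = 1"
    and fin: "finite S"
    and der: "\<And>t. t \<in> {a<..<b} - S \<Longrightarrow> (u has_vector_derivative d t) (at t) \<and> norm (d t) \<le> \<kappa>"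
    and e: "norm e = 1"
  shows "\<bar>arccos (q * (u b \<bullet> e)) - arccos (q * (u a \<bullet> e))\<bar> \<le> \<kappa> * (b - a)"
proof -
  define g where "g t = inverse (- sqrt (1 - (q * (u t \<bullet> e))\<^sup>2)) * (q * (d t \<bullet> e))" for t
  have small: "\<bar>q * (u t \<bullet> e)\<bar> < 1" if "t \<in> {a..b}" for t
  proof -
    have "\<bar>q * (u t \<bullet> e)\<bar> = q * \<bar>u t \<bullet> e\<bar>"
      using \<open>0 < q\<close> by (simp add: abs_mult)
    also have "\<dots> \<le> q * 1"
      using abs_inner_unit_le_1[OF unit[OF that] e] \<open>0 < q\<close> by (intro mult_left_mono) auto
    finally show ?thesis using \<open>q < 1\<close> by simp
  qed
  have "(g has_integral (arccos (q * (u b \<bullet> e)) - arccos (q * (u a \<bullet> e)))) {a..b}"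
  proof (rule fundamental_theorem_of_calculus_interior_strong[OF fin \<open>a \<le> b\<close>])
    fix t assume t: "t \<in> {a<..<b} - S"
    have "((\<lambda>t. q * (u t \<bullet> e)) has_real_derivative q * (d t \<bullet> e)) (at t)"
      using der[OF t] by (intro DERIV_cmult has_real_derivative_inner_left) simp
    moreover have "-1 < q * (u t \<bullet> e)" "q * (u t \<bullet> e) < 1"
      using small[of t] t by auto
    ultimately show "((\<lambda>t. arccos (q * (u t \<bullet> e))) has_vector_derivative g t) (at t)"
      unfolding g_def has_real_derivative_iff_has_vector_derivative[symmetric]
      by (intro DERIV_chain2[OF DERIV_arccos])
  next
    show "continuous_on {a..b} (\<lambda>t. arccos (q * (u t \<bullet> e)))"
      using small by (intro continuous_intros cont) (force simp: abs_less_iff)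
  qed
  moreover have "norm (g t) \<le> \<kappa>" if t: "t \<in> {a..b} - (S \<union> {a, b})" for t
  proof -
    from t have t': "t \<in> {a<..<b} - S" "t \<in> {a..b}" by auto
    let ?x = "u t \<bullet> e"
    have "d t \<bullet> u t = 0"
    proof -
      have "((\<lambda>t. u t \<bullet> u t) has_real_derivative 2 * (u t \<bullet> d t)) (at t)"
        using der[OF t'(1)] by (intro has_real_derivative_inner_self) simp
      moreover have "((\<lambda>t. u t \<bullet> u t) has_real_derivative 0) (at t)"
      proof (rule has_field_derivative_transform_within_open[of "\<lambda>_. 1" 0 t "{a<..<b}"])
        fix x assume "x \<in> {a<..<b}"
        then show "1 = u x \<bullet> u x" using unit[of x] by (simp add: norm_eq_1)
      qed (use t' in auto)
      ultimately have "2 * (u t \<bullet> d t) = 0" by (rule DERIV_unique)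
      then show ?thesis by (simp add: inner_commute)
    qed
    have *: "\<bar>d t \<bullet> e\<bar> \<le> \<kappa> * sqrt (1 - ?x\<^sup>2)"
    proof -
      have "0 \<le> sqrt (1 - ?x\<^sup>2)"
        using abs_inner_unit_le_1[OF unit[OF t'(2)] e] by (simp add: abs_square_le_1)
      then have "norm (d t) * sqrt (1 - ?x\<^sup>2) \<le> \<kappa> * sqrt (1 - ?x\<^sup>2)"
        using der[OF t'(1)] by (intro mult_right_mono) auto
      with inner_deviation_bound[OF unit[OF t'(2)] e \<open>d t \<bullet> u t = 0\<close>] show ?thesis
        by simp
    qed
    have pos: "0 < 1 - (q * ?x)\<^sup>2"
      using small[OF t'(2)] by (simp add: abs_square_less_1)
    have "q\<^sup>2 \<le> 1" using \<open>0 < q\<close> \<open>q < 1\<close> by (simp add: power_le_one)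
    then have "q\<^sup>2 * (1 - ?x\<^sup>2) \<le> 1 - (q * ?x)\<^sup>2"
      by (simp add: algebra_simps power_mult_distrib)
    then have "sqrt (q\<^sup>2 * (1 - ?x\<^sup>2)) \<le> sqrt (1 - (q * ?x)\<^sup>2)"
      by (rule real_sqrt_le_mono)
    then have "q * sqrt (1 - ?x\<^sup>2) \<le> sqrt (1 - (q * ?x)\<^sup>2)"
      using \<open>0 < q\<close> by (simp add: real_sqrt_mult)
    then have "\<kappa> * (q * sqrt (1 - ?x\<^sup>2)) \<le> \<kappa> * sqrt (1 - (q * ?x)\<^sup>2)"
      using \<open>0 \<le> \<kappa>\<close> by (rule mult_left_mono)
    moreover have "q * \<bar>d t \<bullet> e\<bar> \<le> q * (\<kappa> * sqrt (1 - ?x\<^sup>2))"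
      using * \<open>0 < q\<close> by (simp add: mult_left_mono)
    ultimately have "q * \<bar>d t \<bullet> e\<bar> \<le> \<kappa> * sqrt (1 - (q * ?x)\<^sup>2)"
      by (simp add: mult.left_commute)
    then show ?thesis
      using pos \<open>0 < q\<close> by (simp add: g_def abs_mult divide_simps)
  qed
  ultimately have "norm (arccos (q * (u b \<bullet> e)) - arccos (q * (u a \<bullet> e))) \<le> \<kappa> * measure lborel {a..b}"
    using fin \<open>0 \<le> \<kappa>\<close> by (intro has_integral_bound_real[of \<kappa> "S \<union> {a, b}"]) auto
  then show ?thesis using \<open>a \<le> b\<close> by simp
qed

text \<open>
  Letting \<open>q\<close> tend to 1: a point moving on the unit sphere with speed at most \<open>\<kappa>\<close> changes its
  spherical distance from \<open>e\<close> at rate at most \<open>\<kappa>\<close>.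
\<close>

lemma arccos_inner_lipschitz:
  fixes u :: "real \<Rightarrow> 'a::real_inner"
  assumes "a \<le> b" and "0 \<le> \<kappa>"
    and cont: "continuous_on {a..b} u"
    and unit: "\<And>t. t \<in> {a..b} \<Longrightarrow> norm (u t) = 1"
    and fin: "finite S"
    and der: "\<And>t. t \<in> {a<..<b} - S \<Longrightarrow> (u has_vector_derivative d t) (at t) \<and> norm (d t) \<le> \<kappa>"
    and e: "norm e = 1"
  shows "\<bar>arccos (u b \<bullet> e) - arccos (u a \<bullet> e)\<bar> \<le> \<kappa> * (b - a)"
proof -
  let ?f = "\<lambda>q. \<bar>arccos (q * (u b \<bullet> e)) - arccos (q * (u a \<bullet> e))\<bar>"
  have in_range: "-1 \<le> q * x \<and> q * x \<le> 1" if "0 \<le> q" "q \<le> 1" "\<bar>x\<bar> \<le> 1" for q x :: real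
  proof -
    have "\<bar>q * x\<bar> \<le> 1"
      using mult_mono[of q 1 "\<bar>x\<bar>" 1] that by (simp add: abs_mult)
    then show ?thesis by (simp add: abs_le_iff)
  qed
  have "continuous_on (closure {0<..<1}) ?f"
    using assms(1) in_range abs_inner_unit_le_1[OF unit e]
    by (intro continuous_intros) auto
  then have "?f 1 \<le> \<kappa> * (b - a)"
    by (rule continuous_le_on_closure)
      (use arccos_damped_inner_lipschitz[OF assms(1,2) _ _ cont unit fin der e] in auto)
  then show ?thesis by simp
qed

section \<open>Comparison with the circle of extremal curvature\<close>

text \<open>
  The condition \<open>turning\<close> expresses curvature at most \<open>\<kappa>\<close> by first derivatives only: the angle
  between the tangent and any fixed direction is \<open>\<kappa>\<close>-Lipschitz. In this form the bound can be
  integrated without regard to points where the curvature is undefined.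
\<close>

locale curve_of_bounded_turning =
  fixes \<kappa> s :: real and \<gamma> u :: "real \<Rightarrow> 'a::euclidean_space"
  assumes curvature_pos: "0 < \<kappa>"
    and velocity: "\<And>t. t \<in> {0..s} \<Longrightarrow> (\<gamma> has_vector_derivative u t) (at t within {0..s})"
    and unit_speed: "\<And>t. t \<in> {0..s} \<Longrightarrow> norm (u t) = 1"
    and turning: "\<And>t t' e. t \<in> {0..s} \<Longrightarrow> t' \<in> {0..s} \<Longrightarrow> norm e = 1 \<Longrightarrow>
      \<bar>arccos (u t \<bullet> e) - arccos (u t' \<bullet> e)\<bar> \<le> \<kappa> * \<bar>t - t'\<bar>"
begin

lemma velocity_component_has_integral:
  assumes "0 \<le> p" "p \<le> q" "q \<le> s"
  shows "((\<lambda>t. u t \<bullet> e) has_integral (\<gamma> q - \<gamma> p) \<bullet> e) {p..q}"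
proof -
  have "((\<lambda>t. u t \<bullet> e) has_integral (\<gamma> q \<bullet> e - \<gamma> p \<bullet> e)) {p..q}"
  proof (rule fundamental_theorem_of_calculus)
    fix t assume "t \<in> {p..q}"
    then have "(\<gamma> has_vector_derivative u t) (at t within {p..q})"
      using velocity[of t] assms by (auto intro: has_vector_derivative_within_subset)
    then show "((\<lambda>t. \<gamma> t \<bullet> e) has_vector_derivative u t \<bullet> e) (at t within {p..q})"
      unfolding has_real_derivative_iff_has_vector_derivative[symmetric]
      by (rule has_real_derivative_inner_left)
  qed (use assms in auto)
  then show ?thesis by (simp add: inner_diff_left)
qed

lemma tangent_component_ge_cos:
  assumes t: "t \<in> {0..s}" "t0 \<in> {0..s}" and "\<kappa> * \<bar>t - t0\<bar> \<le> pi"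
  shows "cos (\<kappa> * (t - t0)) \<le> u t \<bullet> u t0"
proof -
  have "u t0 \<bullet> u t0 = 1" using unit_speed[OF t(2)] by (simp add: norm_eq_1)
  then have "arccos (u t \<bullet> u t0) \<le> \<kappa> * \<bar>t - t0\<bar>"
    using turning[OF t unit_speed[OF t(2)]] by simp
  moreover have le1: "\<bar>u t \<bullet> u t0\<bar> \<le> 1"
    using t unit_speed by (intro abs_inner_unit_le_1)
  ultimately have "cos (\<kappa> * \<bar>t - t0\<bar>) \<le> cos (arccos (u t \<bullet> u t0))"
    using assms(3) curvature_pos
    by (intro cos_monotone_0_pi_le arccos_lbound) (auto simp: abs_le_iff)
  moreover have "cos (\<kappa> * \<bar>t - t0\<bar>) = cos (\<kappa> * (t - t0))"
    by (cases "t \<ge> t0") (auto simp: algebra_simps cos_diff)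
  ultimately show ?thesis using le1 by (simp add: cos_arccos_abs)
qed

lemma normal_component_le_sin:
  assumes t: "t \<in> {0..s}" "t0 \<in> {0..s}" and small: "\<kappa> * \<bar>t - t0\<bar> \<le> pi / 2"
    and n: "norm n = 1" "u t0 \<bullet> n = 0"
  shows "u t \<bullet> n \<le> sin (\<kappa> * \<bar>t - t0\<bar>)"
proof -
  have "pi / 2 - \<kappa> * \<bar>t - t0\<bar> \<le> arccos (u t \<bullet> n)"
    using turning[OF t n(1)] n(2) by simp
  moreover have le1: "\<bar>u t \<bullet> n\<bar> \<le> 1"
    using t unit_speed n by (intro abs_inner_unit_le_1) auto
  ultimately have "cos (arccos (u t \<bullet> n)) \<le> cos (pi / 2 - \<kappa> * \<bar>t - t0\<bar>)"
    using small by (intro cos_monotone_0_pi_le arccos_ubound) (auto simp: abs_le_iff)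
  then show ?thesis using le1 by (simp add: cos_arccos_abs cos_diff)
qed

text \<open>
  Equality holds on a circle of radius \<open>1 / \<kappa>\<close>. Both endpoints are free so that the lemma gives
  the distance covered after \<open>t0\<close>, before \<open>t0\<close>, and across \<open>t0\<close>.
\<close>

lemma displacement_along_tangent:
  assumes "t0 \<in> {0..s}" and "0 \<le> p" "p \<le> q" "q \<le> s"
    and "\<kappa> * \<bar>p - t0\<bar> \<le> pi" "\<kappa> * \<bar>q - t0\<bar> \<le> pi"
  shows "(sin (\<kappa> * (q - t0)) - sin (\<kappa> * (p - t0))) / \<kappa> \<le> (\<gamma> q - \<gamma> p) \<bullet> u t0"
proof -
  have "((\<lambda>t. cos (\<kappa> * (t - t0))) has_integral
      (sin (\<kappa> * (q - t0)) / \<kappa> - sin (\<kappa> * (p - t0)) / \<kappa>)) {p..q}"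
    using curvature_pos
    by (intro fundamental_theorem_of_calculus \<open>p \<le> q\<close>)
      (auto intro!: derivative_eq_intros
        simp: has_real_derivative_iff_has_vector_derivative[symmetric])
  then have "sin (\<kappa> * (q - t0)) / \<kappa> - sin (\<kappa> * (p - t0)) / \<kappa> \<le> (\<gamma> q - \<gamma> p) \<bullet> u t0"
  proof (rule has_integral_le[OF _ velocity_component_has_integral])
    fix t assume t: "t \<in> {p..q}"
    then have "\<bar>t - t0\<bar> \<le> max \<bar>p - t0\<bar> \<bar>q - t0\<bar>" by auto
    then have "\<kappa> * \<bar>t - t0\<bar> \<le> pi"
      using assms(5,6) curvature_pos
      by (smt (verit) mult_left_mono)
    then show "cos (\<kappa> * (t - t0)) \<le> u t \<bullet> u t0"
      using assms t by (intro tangent_component_ge_cos) auto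
  qed (use assms in auto)
  then show ?thesis by (simp add: diff_divide_distrib)
qed

text \<open>
  The right-hand side is how far a circle of radius \<open>1 / \<kappa>\<close>, tangent to the curve at \<open>\<gamma> t0\<close> and
  bending away from \<open>n\<close>, has receded at time \<open>t\<close>.
\<close>

lemma displacement_along_normal:
  assumes t: "t \<in> {0..s}" "t0 \<in> {0..s}" and small: "\<kappa> * \<bar>t - t0\<bar> \<le> pi / 2"
    and n: "norm n = 1" "u t0 \<bullet> n = 0"
  shows "(\<gamma> t0 - \<gamma> t) \<bullet> n \<le> (1 - cos (\<kappa> * (t - t0))) / \<kappa>"
proof (cases "t0 \<le> t")
  case True
  have "((\<lambda>x. sin (\<kappa> * (x - t0))) has_integral
      (- cos (\<kappa> * (t - t0)) / \<kappa> - - cos (\<kappa> * (t0 - t0)) / \<kappa>)) {t0..t}"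
    using curvature_pos
    by (intro fundamental_theorem_of_calculus True)
      (auto intro!: derivative_eq_intros
        simp: has_real_derivative_iff_has_vector_derivative[symmetric])
  with velocity_component_has_integral[of t0 t "- n"] 
  have "(\<gamma> t - \<gamma> t0) \<bullet> (- n) \<le> - cos (\<kappa> * (t - t0)) / \<kappa> - - cos (\<kappa> * (t0 - t0)) / \<kappa>"
  proof (rule has_integral_le)
    fix x assume x: "x \<in> {t0..t}"
    then have "\<kappa> * \<bar>x - t0\<bar> \<le> pi / 2"
      using small curvature_pos by (smt (verit) atLeastAtMost_iff mult_left_mono)
    then show "u x \<bullet> - n \<le> sin (\<kappa> * (x - t0))"
      using normal_component_le_sin[of x t0 "- n"] x t n by auto
  qed (use t True in auto)
  then show ?thesis by (simp add: diff_divide_distrib inner_diff_left)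
next
  case False
  have "((\<lambda>x. - sin (\<kappa> * (x - t0))) has_integral
      (cos (\<kappa> * (t0 - t0)) / \<kappa> - cos (\<kappa> * (t - t0)) / \<kappa>)) {t..t0}"
    using curvature_pos False
    by (intro fundamental_theorem_of_calculus)
      (auto intro!: derivative_eq_intros
        simp: has_real_derivative_iff_has_vector_derivative[symmetric])
  with velocity_component_has_integral[of t t0 n] 
  have "(\<gamma> t0 - \<gamma> t) \<bullet> n \<le> cos (\<kappa> * (t0 - t0)) / \<kappa> - cos (\<kappa> * (t - t0)) / \<kappa>"
  proof (rule has_integral_le)
    fix x assume x: "x \<in> {t..t0}"
    then have "\<kappa> * \<bar>x - t0\<bar> \<le> pi / 2"
      using small curvature_pos False by (smt (verit) atLeastAtMost_iff mult_left_mono)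
    then have "u x \<bullet> n \<le> sin (\<kappa> * \<bar>x - t0\<bar>)"
      using normal_component_le_sin[of x t0 n] x t n by auto
    also have "\<dots> = - sin (\<kappa> * (x - t0))"
      using x by (simp flip: sin_minus add: algebra_simps)
    finally show "u x \<bullet> n \<le> - sin (\<kappa> * (x - t0))" .
  qed (use t False in auto)
  then show ?thesis by (simp add: diff_divide_distrib)
qed

text \<open>
  A special case of Schur's comparison theorem: measured along the tangent at the midpoint, each
  quarter turn contributes at least one radius.
\<close>

lemma half_turn_chord:
  assumes "pi / (2 * \<kappa>) \<le> t0" "t0 + pi / (2 * \<kappa>) \<le> s"
  shows "2 / \<kappa> \<le> dist (\<gamma> (t0 + pi / (2 * \<kappa>))) (\<gamma> (t0 - pi / (2 * \<kappa>)))"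
proof -
  define h where "h = pi / (2 * \<kappa>)"
  have "0 < h" and kh: "\<kappa> * h = pi / 2"
    using curvature_pos by (simp_all add: h_def)
  have t0: "t0 \<in> {0..s}" using assms \<open>0 < h\<close> by (auto simp: h_def[symmetric])
  have "2 / \<kappa> \<le> (\<gamma> (t0 + h) - \<gamma> (t0 - h)) \<bullet> u t0"
    using displacement_along_tangent[OF t0, of "t0 - h" "t0 + h"] assms \<open>0 < h\<close> kh
    by (simp add: h_def[symmetric])
  also have "\<dots> \<le> norm (\<gamma> (t0 + h) - \<gamma> (t0 - h))"
    using norm_cauchy_schwarz[of "\<gamma> (t0 + h) - \<gamma> (t0 - h)" "u t0"] unit_speed[OF t0] by simp
  finally show ?thesis by (simp add: h_def dist_norm)
qed

text \<open>
  Put \<open>r = 1 / \<kappa>\<close>, let \<open>R\<close> be the distance of \<open>\<gamma> t0\<close> from \<open>C\<close>, and let \<open>\<phi> = \<kappa> (t - t0)\<close>. In the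
  plane spanned by the radius and the tangent at \<open>t0\<close>, the comparison circle reaches the point with
  coordinates \<open>(R - r) + r cos \<phi>\<close> and \<open>r sin \<phi>\<close>. The curve is at least as far out in both
  coordinates, and \<open>cos \<phi> \<ge> 0\<close> makes the cross term harmless. The summand \<open>(R - r)\<^sup>2\<close> gives strictness
  when \<open>R > r\<close>.
\<close>

lemma curve_stays_outside_ball:
  assumes t: "t \<in> {0..s}" "t0 \<in> {0..s}" and small: "\<kappa> * \<bar>t - t0\<bar> \<le> pi / 2"
    and perp: "(\<gamma> t0 - C) \<bullet> u t0 = 0" and R: "1 / \<kappa> \<le> dist (\<gamma> t0) C"
  shows "(1 / \<kappa>)\<^sup>2 + (dist (\<gamma> t0) C - 1 / \<kappa>)\<^sup>2 \<le> (dist (\<gamma> t) C)\<^sup>2"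
proof -
  define r where "r = 1 / \<kappa>"
  define R where "R = dist (\<gamma> t0) C"
  define n where "n = (\<gamma> t0 - C) /\<^sub>R R"
  define T where "T = u t0"
  define x where "x = \<gamma> t - C"
  define \<phi> where "\<phi> = \<kappa> * (t - t0)"
  have "0 < r" "r \<le> R" "0 < R"
    using curvature_pos R by (auto simp: r_def R_def intro: less_le_trans[of _ "1/\<kappa>"])
  have n: "norm n = 1" using \<open>0 < R\<close> by (simp add: n_def R_def dist_norm)
  have Rn: "\<gamma> t0 - C = R *\<^sub>R n" using \<open>0 < R\<close> by (simp add: n_def)
  have Tn: "T \<bullet> n = 0" using perp by (simp add: n_def T_def inner_commute)
  have T: "norm T = 1" using unit_speed[OF t(2)] by (simp add: T_def)
  have nn: "n \<bullet> n = 1" and TT: "T \<bullet> T = 1" using n T by (simp_all add: norm_eq_1)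
  have cos0: "0 \<le> cos \<phi>"
  proof (rule cos_ge_zero)
    have "\<bar>\<phi>\<bar> \<le> pi / 2" using small curvature_pos by (simp add: \<phi>_def abs_mult)
    then show "- (pi / 2) \<le> \<phi>" "\<phi> \<le> pi / 2" by auto
  qed
  have "(\<gamma> t0 - \<gamma> t) \<bullet> n \<le> r - r * cos \<phi>"
    using displacement_along_normal[OF t small n] Tn
    by (simp add: T_def r_def \<phi>_def diff_divide_distrib)
  moreover have "(\<gamma> t0 - \<gamma> t) \<bullet> n = R - x \<bullet> n"
  proof -
    have "\<gamma> t0 - \<gamma> t = R *\<^sub>R n - x" using Rn by (simp add: x_def algebra_simps)
    then show ?thesis by (simp add: inner_diff_left nn)
  qed
  ultimately have N: "(R - r) + r * cos \<phi> \<le> x \<bullet> n" by simp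
  have xT: "x \<bullet> T = (\<gamma> t - \<gamma> t0) \<bullet> T"
    using perp by (simp add: x_def T_def inner_diff_left)
  have small': "\<kappa> * \<bar>t - t0\<bar> \<le> pi" "\<kappa> * \<bar>t0 - t0\<bar> \<le> pi" using small pi_gt_zero by (auto simp del: pi_gt_zero)
  have sin_le: "\<bar>r * sin \<phi>\<bar> \<le> \<bar>x \<bullet> T\<bar>"
  proof (cases "t0 \<le> t")
    case True
    have "0 \<le> sin \<phi>"
      using small' True curvature_pos by (intro sin_ge_zero) (auto simp: \<phi>_def)
    moreover have "r * sin \<phi> \<le> x \<bullet> T"
      using displacement_along_tangent[OF t(2), of t0 t] t True small'
      by (simp add: xT[unfolded T_def] T_def r_def \<phi>_def)
    ultimately show ?thesis using \<open>0 < r\<close> by simp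
  next
    case False
    have "0 \<le> sin (- \<phi>)"
      using small' False curvature_pos by (intro sin_ge_zero) (auto simp: \<phi>_def simp flip: mult_minus_right)
    moreover have "- (r * sin \<phi>) \<le> - (x \<bullet> T)"
      using displacement_along_tangent[OF t(2), of t t0] t False small'
      by (simp add: xT[unfolded T_def] T_def r_def \<phi>_def inner_diff_left)
    ultimately show ?thesis
      using \<open>0 < r\<close> mult_nonneg_nonneg[of r "sin (- \<phi>)"] by simp
  qed
  \<comment> \<open>Bessel's inequality for the orthonormal pair \<open>n\<close>, \<open>T\<close>.\<close>
  have "0 \<le> (x - (x \<bullet> n) *\<^sub>R n - (x \<bullet> T) *\<^sub>R T) \<bullet> (x - (x \<bullet> n) *\<^sub>R n - (x \<bullet> T) *\<^sub>R T)"
    by simp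
  also have "\<dots> = x \<bullet> x - (x \<bullet> n)\<^sup>2 - (x \<bullet> T)\<^sup>2"
    using Tn by (simp add: inner_diff_left inner_diff_right nn TT inner_commute power2_eq_square)
  finally have "(x \<bullet> n)\<^sup>2 + (x \<bullet> T)\<^sup>2 \<le> (norm x)\<^sup>2"
    by (simp add: power2_norm_eq_inner)
  moreover have "((R - r) + r * cos \<phi>)\<^sup>2 \<le> (x \<bullet> n)\<^sup>2"
    using N \<open>r \<le> R\<close> \<open>0 < r\<close> cos0 by (intro power_mono) auto
  moreover have "(r * sin \<phi>)\<^sup>2 \<le> (x \<bullet> T)\<^sup>2"
    using sin_le by (simp add: abs_le_square_iff)
  moreover have "((R - r) + r * cos \<phi>)\<^sup>2 + (r * sin \<phi>)\<^sup>2
      = r\<^sup>2 + (R - r)\<^sup>2 + 2 * (R - r) * (r * cos \<phi>)"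
  proof -
    have "(r * cos \<phi>)\<^sup>2 + (r * sin \<phi>)\<^sup>2 = r\<^sup>2"
      by (simp add: power_mult_distrib flip: distrib_left)
    then show ?thesis by (simp add: power2_sum)
  qed
  moreover have "0 \<le> 2 * (R - r) * (r * cos \<phi>)"
    using \<open>r \<le> R\<close> \<open>0 < r\<close> cos0 by simp
  ultimately have "r\<^sup>2 + (R - r)\<^sup>2 \<le> (norm x)\<^sup>2" by linarith
  then show ?thesis by (simp add: r_def R_def x_def dist_norm)
qed

lemma perpendicular_at_local_farthest_point:
  assumes "0 < t0" "t0 < s"
    and far: "\<forall>\<^sub>F t in at t0. dist (\<gamma> t) C \<le> dist (\<gamma> t0) C"
  shows "(\<gamma> t0 - C) \<bullet> u t0 = 0"
proof -
  obtain d where "0 < d" and d: "\<And>t. t \<noteq> t0 \<Longrightarrow> dist t t0 < d \<Longrightarrow> dist (\<gamma> t) C \<le> dist (\<gamma> t0) C"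
    using far by (auto simp: eventually_at)
  have "(\<gamma> has_vector_derivative u t0) (at t0)"
    using velocity[of t0] assms(1,2) by (simp add: at_within_Icc_at)
  then have "((\<lambda>t. (\<gamma> t - C) \<bullet> (\<gamma> t - C)) has_real_derivative 2 * ((\<gamma> t0 - C) \<bullet> u t0)) (at t0)"
    by (intro has_real_derivative_inner_self) (simp add: has_vector_derivative_diff_const)
  then have "2 * ((\<gamma> t0 - C) \<bullet> u t0) = 0"
  proof (rule DERIV_local_max[OF _ \<open>0 < d\<close>], intro allI impI)
    fix t assume "\<bar>t0 - t\<bar> < d"
    then have "dist (\<gamma> t) C \<le> dist (\<gamma> t0) C"
      using d[of t] by (cases "t = t0") (auto simp: dist_real_def)
    then show "(\<gamma> t - C) \<bullet> (\<gamma> t - C) \<le> (\<gamma> t0 - C) \<bullet> (\<gamma> t0 - C)"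
      by (simp add: dist_norm norm_le)
  qed
  then show ?thesis by simp
qed

lemma continuous_on_curve: "continuous_on {0..s} \<gamma>"
  using velocity has_vector_derivative_continuous
  unfolding continuous_on_eq_continuous_within by blast

text \<open>
  At the point farthest from \<open>C\<close> the radius is perpendicular to the curve, and the distance exceeds
  \<open>1 / \<kappa>\<close>. Neither end can lie within a quarter turn of that point, where the curve is strictly
  outside the ball, so a whole half turn fits into the curve.
\<close>

lemma half_turn_if_ends_in_ball_and_exits:
  assumes ends: "dist (\<gamma> 0) C \<le> 1 / \<kappa>" "dist (\<gamma> s) C \<le> 1 / \<kappa>"
    and exit: "t1 \<in> {0..s}" "1 / \<kappa> < dist (\<gamma> t1) C"
  shows "\<exists>p\<in>{0..s}. \<exists>q\<in>{0..s}. 2 / \<kappa> \<le> dist (\<gamma> p) (\<gamma> q)"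
proof -
  have "continuous_on {0..s} (\<lambda>t. dist (\<gamma> t) C)"
    by (intro continuous_intros continuous_on_curve)
  then obtain t0 where t0: "t0 \<in> {0..s}"
    and far: "\<And>t. t \<in> {0..s} \<Longrightarrow> dist (\<gamma> t) C \<le> dist (\<gamma> t0) C"
    using continuous_attains_sup[of "{0..s}" "\<lambda>t. dist (\<gamma> t) C"] exit(1) by fastforce
  have R: "1 / \<kappa> < dist (\<gamma> t0) C" using far[OF exit(1)] exit(2) by simp
  with ends have "t0 \<noteq> 0" "t0 \<noteq> s" by auto
  with t0 have interior: "0 < t0" "t0 < s" by auto
  have "\<forall>\<^sub>F t in at t0. t \<in> {0<..<s}"
    using interior by (intro eventually_at_in_open') auto
  then have perp: "(\<gamma> t0 - C) \<bullet> u t0 = 0"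
    by (intro perpendicular_at_local_farthest_point interior) (auto elim!: eventually_mono intro!: far)
  \<comment> \<open>The ends of the curve satisfy the condition on \<open>t\<close>.\<close>
  have no_end: "\<not> \<kappa> * \<bar>t - t0\<bar> \<le> pi / 2" if t: "t \<in> {0..s}" "dist (\<gamma> t) C \<le> 1 / \<kappa>" for t
  proof
    assume "\<kappa> * \<bar>t - t0\<bar> \<le> pi / 2"
    with t t0 R have "(1 / \<kappa>)\<^sup>2 + (dist (\<gamma> t0) C - 1 / \<kappa>)\<^sup>2 \<le> (dist (\<gamma> t) C)\<^sup>2"
      by (intro curve_stays_outside_ball perp) auto
    moreover have "(dist (\<gamma> t) C)\<^sup>2 \<le> (1 / \<kappa>)\<^sup>2"
      using t by (intro power_mono) auto
    moreover have "0 < (dist (\<gamma> t0) C - 1 / \<kappa>)\<^sup>2"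
      using R by simp
    ultimately show False by linarith
  qed
  from no_end[of 0] no_end[of s] have "pi / (2 * \<kappa>) \<le> t0" "t0 + pi / (2 * \<kappa>) \<le> s"
    using ends interior curvature_pos by (auto simp: field_simps)
  moreover have "0 \<le> pi / (2 * \<kappa>)" using curvature_pos by simp
  ultimately show ?thesis
    using interior half_turn_chord[of t0]
    by (intro bexI[of _ "t0 + pi / (2 * \<kappa>)"] bexI[of _ "t0 - pi / (2 * \<kappa>)"]) auto
qed

end

text \<open>
  The finitely many points where the second derivative does not exist are absorbed by the
  integration in \<open>arccos_inner_lipschitz\<close>.
\<close>

lemma constrained_arc_bounded_turning:
  assumes "0 < \<kappa>" and "constrained_arc \<kappa> s \<gamma>"
  obtains u where "curve_of_bounded_turning \<kappa> s \<gamma> u"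
proof -
  from assms(2) obtain u where
    vel: "\<And>t. t \<in> {0..s} \<Longrightarrow> (\<gamma> has_vector_derivative u t) (at t within {0..s})"
    and unit: "\<And>t. t \<in> {0..s} \<Longrightarrow> norm (u t) = 1"
    and cont: "continuous_on {0..s} u"
    and pw: "u piecewise_C1_differentiable_on {0..s}"
    and bound: "\<And>t a. t \<in> {0..s} \<Longrightarrow> (u has_vector_derivative a) (at t within {0..s}) \<Longrightarrow> norm a \<le> \<kappa>"
    unfolding constrained_arc_def by blast
  from pw obtain S d where "finite S"
    and d: "\<And>t. t \<in> {0..s} - S \<Longrightarrow> (u has_vector_derivative d t) (at t)"
    unfolding piecewise_C1_differentiable_on_def C1_differentiable_on_def by blast
  have lip: "\<bar>arccos (u q \<bullet> e) - arccos (u p \<bullet> e)\<bar> \<le> \<kappa> * (q - p)"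
    if "0 \<le> p" "p \<le> q" "q \<le> s" "norm e = 1" for p q e
  proof (rule arccos_inner_lipschitz[OF \<open>p \<le> q\<close> _ _ _ \<open>finite S\<close>])
    show "continuous_on {p..q} u" using cont by (rule continuous_on_subset) (use that in auto)
    fix t assume "t \<in> {p<..<q} - S"
    then have "t \<in> {0..s} - S" using that by auto
    then show "(u has_vector_derivative d t) (at t) \<and> norm (d t) \<le> \<kappa>"
      using d bound has_vector_derivative_at_within by blast
  qed (use that unit assms in auto)
  have "curve_of_bounded_turning \<kappa> s \<gamma> u"
  proof
    fix t t' and e :: "real^3"
    assume "t \<in> {0..s}" "t' \<in> {0..s}" "norm e = 1"
    then show "\<bar>arccos (u t \<bullet> e) - arccos (u t' \<bullet> e)\<bar> \<le> \<kappa> * \<bar>t - t'\<bar>"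
      using lip[of t t' e] lip[of t' t e] by (cases "t \<le> t'") auto
  qed (use assms vel unit in auto)
  then show ?thesis by (rule that)
qed

section \<open>Spheres centred on the vertical axis\<close>

lemma dist_axis_point_squared:
  "(dist p (vector [0, 0, c] :: real^3))\<^sup>2 = (p$1)\<^sup>2 + (p$2)\<^sup>2 + (p$3 - c)\<^sup>2"
  unfolding dist_norm power2_norm_eq_inner
  by (simp add: inner_vec_def sum_3 power2_eq_square)

lemma above_sphere_outside:
  assumes "0 < \<kappa>" and "above_sphere \<kappa> c p"
  shows "1 / \<kappa> < dist p (vector [0, 0, c])"
proof -
  from assms(2) have "0 \<le> 1 / \<kappa>\<^sup>2 - (p$1)\<^sup>2 - (p$2)\<^sup>2"
    and "sqrt (1 / \<kappa>\<^sup>2 - (p$1)\<^sup>2 - (p$2)\<^sup>2) < p$3 - c"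
    by (auto simp: above_sphere_def)
  then have "1 / \<kappa>\<^sup>2 - (p$1)\<^sup>2 - (p$2)\<^sup>2 < (p$3 - c)\<^sup>2"
    by (metis real_sqrt_ge_zero power_strict_mono pos2 real_sqrt_pow2)
  then have "(1 / \<kappa>)\<^sup>2 < (dist p (vector [0, 0, c]))\<^sup>2"
    by (simp add: dist_axis_point_squared power_divide)
  then show ?thesis by (rule power_less_imp_less_base) simp
qed

text \<open>
  The height of the centre of that sphere of radius \<open>1 / \<kappa>\<close> about a point of the vertical axis whose
  upper hemisphere contains \<open>p\<close>. It orders the points of the cylinder by how far the sphere has to
  slide upwards to reach them.
\<close>

definition sphere_height :: "real \<Rightarrow> real^3 \<Rightarrow> real" where
  "sphere_height \<kappa> p = p$3 - sqrt (1 / \<kappa>\<^sup>2 - (p$1)\<^sup>2 - (p$2)\<^sup>2)"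

text \<open>
  Above the equatorial plane \<open>z = c\<close>, being on or below the upper hemisphere means being in the
  ball. Below that plane both equivalences may fail, which is why \<open>c < p$3\<close> is required.
\<close>

lemma sphere_height_compare:
  assumes "0 < \<kappa>" and "(p$1)\<^sup>2 + (p$2)\<^sup>2 < 1 / \<kappa>\<^sup>2" and "c < p$3"
  shows "sphere_height \<kappa> p \<le> c \<longleftrightarrow> dist p (vector [0, 0, c]) \<le> 1 / \<kappa>"
    and "c \<le> sphere_height \<kappa> p \<longleftrightarrow> 1 / \<kappa> \<le> dist p (vector [0, 0, c])"
proof -
  let ?A = "1 / \<kappa>\<^sup>2 - (p$1)\<^sup>2 - (p$2)\<^sup>2" and ?D = "dist p (vector [0, 0, c])"
  have A: "0 \<le> ?A" using assms(2) by simp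
  have D: "?D\<^sup>2 = (1 / \<kappa>)\<^sup>2 - ?A + (p$3 - c)\<^sup>2"
    by (simp add: dist_axis_point_squared power_divide)
  have "?D \<le> 1 / \<kappa> \<longleftrightarrow> ?D\<^sup>2 \<le> (1 / \<kappa>)\<^sup>2" "1 / \<kappa> \<le> ?D \<longleftrightarrow> (1 / \<kappa>)\<^sup>2 \<le> ?D\<^sup>2"
    using assms(1) by (simp_all add: power_mono_iff del: power_divide)
  moreover have "p$3 - c \<le> sqrt ?A \<longleftrightarrow> (p$3 - c)\<^sup>2 \<le> ?A" "sqrt ?A \<le> p$3 - c \<longleftrightarrow> ?A \<le> (p$3 - c)\<^sup>2"
    using A assms(3) power_mono_iff[of "p$3 - c" "sqrt ?A" 2] power_mono_iff[of "sqrt ?A" "p$3 - c" 2]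
    by simp_all
  ultimately show "sphere_height \<kappa> p \<le> c \<longleftrightarrow> ?D \<le> 1 / \<kappa>" "c \<le> sphere_height \<kappa> p \<longleftrightarrow> 1 / \<kappa> \<le> ?D"
    unfolding D sphere_height_def by linarith+
qed

lemma dist_sphere_height_centre:
  assumes "0 < \<kappa>" and "(p$1)\<^sup>2 + (p$2)\<^sup>2 < 1 / \<kappa>\<^sup>2"
  shows "sphere_height \<kappa> p < p$3"
    and "dist p (vector [0, 0, sphere_height \<kappa> p]) = 1 / \<kappa>"
proof -
  show *: "sphere_height \<kappa> p < p$3"
    using assms(2) by (simp add: sphere_height_def)
  show "dist p (vector [0, 0, sphere_height \<kappa> p]) = 1 / \<kappa>"
    using sphere_height_compare[OF assms *] by simp
qed

text \<open>
  By the parallelogram law, points of a sphere at distance \<open>2 r\<close> or more are antipodal, and an open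
  hemisphere contains no antipodal pair.
\<close>

lemma open_hemisphere_chord_less_diameter:
  fixes x y C e :: "'a::real_inner"
  assumes "dist x C = r" "dist y C = r" and "0 < (x - C) \<bullet> e" "0 < (y - C) \<bullet> e"
  shows "dist x y < 2 * r"
proof (rule ccontr)
  assume far: "\<not> dist x y < 2 * r"
  define a b where "a = x - C" and "b = y - C"
  have "0 \<le> r" using assms(1) zero_le_dist by metis
  have "(norm (a + b))\<^sup>2 = 2 * (norm a)\<^sup>2 + 2 * (norm b)\<^sup>2 - (norm (a - b))\<^sup>2"
    by (simp add: power2_norm_eq_inner algebra_simps inner_commute)
  also have "\<dots> = (2 * r)\<^sup>2 - (dist x y)\<^sup>2"
    using assms(1,2) by (simp add: a_def b_def dist_norm)
  also have "\<dots> \<le> 0" using far \<open>0 \<le> r\<close> power_mono[of "2 * r" "dist x y" 2] by simp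
  finally have "a + b = 0" by simp
  moreover have "0 < (a + b) \<bullet> e" using assms(3,4) by (simp add: a_def b_def inner_add_left)
  ultimately show False by simp
qed

text \<open>
  The sliding argument. The last sphere touched is tangent to the arc at the point \<open>\<gamma> t0\<close> of maximal
  \<open>sphere_height\<close>, because near \<open>t0\<close> the arc lies in its ball. By comparison the arc is also outside
  that ball for a quarter turn on either side, hence on the sphere, as long as it stays above the
  equatorial plane. It does: a point of the equatorial plane strictly inside the cylinder is in the
  open ball.
\<close>

lemma arc_in_cylinder_not_above_upper_hemisphere:
  assumes "curve_of_bounded_turning \<kappa> s \<gamma> u"
    and cyl: "\<And>t. t \<in> {0..s} \<Longrightarrow> (\<gamma> t $ 1)\<^sup>2 + (\<gamma> t $ 2)\<^sup>2 < 1 / \<kappa>\<^sup>2"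
    and ends: "sphere_height \<kappa> (\<gamma> 0) \<le> c" "sphere_height \<kappa> (\<gamma> s) \<le> c"
    and "t1 \<in> {0..s}"
  shows "sphere_height \<kappa> (\<gamma> t1) \<le> c"
proof (rule ccontr)
  interpret curve_of_bounded_turning \<kappa> s \<gamma> u by fact
  note k = curvature_pos
  let ?h = "\<lambda>t. sphere_height \<kappa> (\<gamma> t)"
  assume above: "\<not> ?h t1 \<le> c"
  have "continuous_on {0..s} ?h"
    unfolding sphere_height_def by (intro continuous_intros continuous_on_curve)
  then obtain t0 where t0: "t0 \<in> {0..s}" and top: "\<And>t. t \<in> {0..s} \<Longrightarrow> ?h t \<le> ?h t0"
    using continuous_attains_sup[of "{0..s}" ?h] \<open>t1 \<in> {0..s}\<close> by fastforce
  define c0 where "c0 = ?h t0"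
  define C where "C = (vector [0, 0, c0] :: real^3)"
  have "c < c0" using top[OF \<open>t1 \<in> {0..s}\<close>] above by (simp add: c0_def)
  with ends have "t0 \<noteq> 0" "t0 \<noteq> s" by (auto simp: c0_def)
  with t0 have interior: "0 < t0" "t0 < s" by auto
  have t0_on: "c0 < \<gamma> t0 $ 3" "dist (\<gamma> t0) C = 1 / \<kappa>"
    using dist_sphere_height_centre[OF k cyl[OF t0]] by (simp_all add: c0_def C_def)
  have perp: "(\<gamma> t0 - C) \<bullet> u t0 = 0"
  proof (rule perpendicular_at_local_farthest_point[OF interior])
    have "\<forall>\<^sub>F t in at t0. t \<in> {0<..<s}"
      using interior by (intro eventually_at_in_open') auto
    moreover have "((\<lambda>t. \<gamma> t $ 3) \<longlongrightarrow> \<gamma> t0 $ 3) (at t0)"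
    proof -
      have "isCont \<gamma> t0"
        using continuous_on_curve interior by (intro continuous_on_interior) auto
      then show ?thesis by (intro tendsto_intros) (simp add: isCont_def)
    qed
    then have "\<forall>\<^sub>F t in at t0. c0 < \<gamma> t $ 3"
      using t0_on(1) by (rule order_tendstoD)
    ultimately show "\<forall>\<^sub>F t in at t0. dist (\<gamma> t) C \<le> dist (\<gamma> t0) C"
    proof eventually_elim
      case (elim t)
      then have "t \<in> {0..s}" by auto
      then show ?case
        using sphere_height_compare(1)[OF k cyl elim(2)] top[of t] t0_on(2)
        by (simp add: c0_def C_def)
    qed
  qed
  define J where "J = {0..s} \<inter> {t0 - pi / (2 * \<kappa>)..t0 + pi / (2 * \<kappa>)}"
  have outside: "1 / \<kappa> \<le> dist (\<gamma> t) C" if "t \<in> J" for t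
  proof -
    have "\<bar>t - t0\<bar> \<le> pi / (2 * \<kappa>)" using that by (auto simp: J_def)
    then have "\<kappa> * \<bar>t - t0\<bar> \<le> pi / 2" using k by (simp add: field_simps)
    then have "(1 / \<kappa>)\<^sup>2 \<le> (dist (\<gamma> t) C)\<^sup>2"
      using curve_stays_outside_ball[OF _ t0 _ perp, of t] that t0_on(2) by (simp add: J_def)
    then show ?thesis by (rule power2_le_imp_le) simp
  qed
  \<comment> \<open>By connectedness, an arc that avoids the equatorial plane stays on the side of \<open>\<gamma> t0\<close>.\<close>
  have off_equator: "\<gamma> t $ 3 \<noteq> c0" if "t \<in> J" for t
  proof
    assume "\<gamma> t $ 3 = c0"
    then have "(dist (\<gamma> t) C)\<^sup>2 < (1 / \<kappa>)\<^sup>2"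
      using cyl[of t] that by (simp add: C_def J_def dist_axis_point_squared power_divide)
    then show False using outside[OF that] k by (smt (verit) power_mono divide_nonneg_nonneg)
  qed
  have "connected ((\<lambda>t. \<gamma> t $ 3) ` J)"
  proof (rule connected_continuous_image)
    show "continuous_on J (\<lambda>t. \<gamma> t $ 3)"
      by (intro continuous_intros continuous_on_subset[OF continuous_on_curve]) (auto simp: J_def)
  qed (simp add: J_def)
  moreover have "t0 \<in> J" using interior k by (simp add: J_def)
  ultimately have upper: "c0 < \<gamma> t $ 3" if "t \<in> J" for t
    using connectedD_interval[of _ "\<gamma> t $ 3" "\<gamma> t0 $ 3" c0] that off_equator t0_on(1)
    by (smt (verit, best) image_iff)
  have "?h t = c0" if "t \<in> J" for t
    using sphere_height_compare(2)[OF k cyl upper[OF that]] outside[OF that] that top[of t]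
    by (auto simp: C_def c0_def J_def)
  then have "0 \<notin> J" "s \<notin> J" using ends \<open>c < c0\<close> by force+
  then have wide: "pi / (2 * \<kappa>) \<le> t0" "t0 + pi / (2 * \<kappa>) \<le> s"
    using interior k by (auto simp: J_def not_le intro: less_imp_le)
  let ?p = "t0 + pi / (2 * \<kappa>)" and ?q = "t0 - pi / (2 * \<kappa>)"
  have "?p \<in> J" "?q \<in> J" using wide interior k by (auto simp: J_def)
  moreover have "dist (\<gamma> t) C = 1 / \<kappa>" "0 < (\<gamma> t - C) \<bullet> axis 3 1" if "t \<in> J" for t
    using sphere_height_compare(1)[OF k cyl upper[OF that]] outside[OF that] that top[of t] upper[OF that]
    by (auto simp: C_def c0_def J_def inner_axis)
  ultimately have "dist (\<gamma> ?p) (\<gamma> ?q) < 2 * (1 / \<kappa>)"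
    by (intro open_hemisphere_chord_less_diameter[where C = C and e = "axis 3 1"])
  then show False using half_turn_chord[OF wide] by simp
qed

section \<open>Arcs with ends on a sphere and a point above it\<close>

theorem lemma2p5:
  fixes \<kappa> s :: real and \<gamma> :: "real \<Rightarrow> real^3"
  assumes "\<kappa> > 0" and "constrained_arc \<kappa> s \<gamma>"
  shows "(\<gamma> ` {0..s} \<subseteq> half_cylinder \<kappa> \<longrightarrow>
            \<not> (ends_in_xy_plane s \<gamma> \<and> passes_above_sphere \<kappa> s \<gamma>)) \<and>
         (passes_above_sphere \<kappa> s \<gamma> \<longrightarrow> diameter (\<gamma> ` {0..s}) \<ge> 2 / \<kappa>)"
proof (intro conjI impI notI)
  obtain u where u: "curve_of_bounded_turning \<kappa> s \<gamma> u"
    using constrained_arc_bounded_turning[OF assms] .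
  interpret curve_of_bounded_turning \<kappa> s \<gamma> u by (rule u)
  have "0 < s" using assms(2) by (simp add: constrained_arc_def)
  {
    assume "passes_above_sphere \<kappa> s \<gamma>"
    then obtain c t1 where "dist (\<gamma> 0) (vector [0, 0, c]) = 1 / \<kappa>"
      "dist (\<gamma> s) (vector [0, 0, c]) = 1 / \<kappa>" "t1 \<in> {0..s}" "above_sphere \<kappa> c (\<gamma> t1)"
      by (auto simp: passes_above_sphere_def z_sphere_def dist_commute)
    then obtain p q where pq: "p \<in> {0..s}" "q \<in> {0..s}" "2 / \<kappa> \<le> dist (\<gamma> p) (\<gamma> q)"
      using half_turn_if_ends_in_ball_and_exits[of "vector [0, 0, c]" t1]
        above_sphere_outside[OF assms(1)] by auto
    have "bounded (\<gamma> ` {0..s})"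
      by (intro compact_imp_bounded compact_continuous_image continuous_on_curve) simp
    then have "dist (\<gamma> p) (\<gamma> q) \<le> diameter (\<gamma> ` {0..s})"
      using pq by (intro diameter_bounded_bound) auto
    with pq show "2 / \<kappa> \<le> diameter (\<gamma> ` {0..s})" by simp
  next
    assume "\<gamma> ` {0..s} \<subseteq> half_cylinder \<kappa>"
    then have cyl: "\<And>t. t \<in> {0..s} \<Longrightarrow> (\<gamma> t $ 1)\<^sup>2 + (\<gamma> t $ 2)\<^sup>2 < 1 / \<kappa>\<^sup>2"
      unfolding half_cylinder_def by blast
    assume "ends_in_xy_plane s \<gamma> \<and> passes_above_sphere \<kappa> s \<gamma>"
    then obtain c t1 where "c < 0" and plane: "\<gamma> 0 $ 3 = 0" "\<gamma> s $ 3 = 0"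
      and on: "dist (\<gamma> 0) (vector [0, 0, c]) = 1 / \<kappa>" "dist (\<gamma> s) (vector [0, 0, c]) = 1 / \<kappa>"
      and t1: "t1 \<in> {0..s}" "above_sphere \<kappa> c (\<gamma> t1)"
      by (auto simp: ends_in_xy_plane_def passes_above_sphere_def z_sphere_def dist_commute)
    \<comment> \<open>As \<open>c < 0\<close>, the ends lie above the equatorial plane of the sphere, hence on its upper hemisphere.\<close>
    have "sphere_height \<kappa> (\<gamma> 0) \<le> c" "sphere_height \<kappa> (\<gamma> s) \<le> c"
      using sphere_height_compare(1)[OF assms(1) cyl[of 0], of c]
        sphere_height_compare(1)[OF assms(1) cyl[of s], of c] \<open>0 < s\<close> \<open>c < 0\<close> plane on by simp_all
    then have "sphere_height \<kappa> (\<gamma> t1) \<le> c"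
      using arc_in_cylinder_not_above_upper_hemisphere[OF u cyl] t1(1) by blast
    then show False using t1(2) by (simp add: above_sphere_def sphere_height_def)
  }
qed

end
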